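(* Let $\mathcal A$ be an arrangement of $n$ hyperplanes of rank $r$ in a finite-dimensional complex vector space $V$. Then $$\mathrm{Hilb}(C_{\mathcal A,-1};q)=q^{n-r}\,T_{\mathcal A}\!\left(1,\frac1q\right).$$
   Context: $\mathbb C[V^*]$ denotes the algebra of polynomial functions on $V$. A (central) arrangement $\mathcal A=\{H_1,\dots,H_n\}$ in $V$ is a finite collection (repetitions allowed) of hyperplanes $H_i=\{l_i=0\}$ with $l_i\in V^*$; the degenerate case $l_i=0$ (a loop) is allowed. Its matroid is the linear matroid of $l_1,\dots,l_n$ with rank function $r(\cdot)$; the rank of $\mathcal A$ is $r=\dim\mathrm{span}(l_1,\dots,l_n)$. For nonzero $h\in V$, $\rho_{\mathcal A}(h)$ is the number of hyperplanes of $\mathcal A$ not containing $h$, i.e. the number of $i$ with $l_i(h)\neq 0$. $C_{\mathcal A,-1}$ is the space of $f\in\mathbb C[V^*]$ such that for every nonzero $h\in V$ the $\rho_{\mathcal A}(h)$-th power of the directional derivative along $h$ annihilates $f$ (equivalently, $f$ has degree at most $\rho_{\mathcal A}(h)-1$ on every affine line of direction $h$); it is graded by degree, and $\mathrm{Hilb}(C;q)=\sum_i \dim C_i\,q^i$. The Tutte polynomial is $T_{\mathcal A}(x,y)=\sum_{S\subseteq[n]}(x-1)^{r-r(S)}(y-1)^{|S|-r(S)}$.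
   Formalization: The arrangement is assumed essential, r = dim V; if r < dim V some nonzero h lies in all hyperplanes, so ρ(h) = 0 and C_{A,-1} = 0, while the right side is nonzero (e.g. n = 0, V = C gives 0 versus 1), so the formula fails in every excluded case. *)

theory Defs
  imports "HOL-Analysis.Analysis"
    "HOL-Library.Function_Algebras"
    "HOL-Computational_Algebra.Formal_Laurent_Series"
begin

text \<open>The complex vector space of all functions from \<open>V\<close> to the complex numbers; it contains
  the dual space of \<open>V\<close> and the polynomial functions on \<open>V\<close>.\<close>

definition fun_scale :: "complex \<Rightarrow> ('v \<Rightarrow> complex) \<Rightarrow> 'v \<Rightarrow> complex" where
  "fun_scale c f = (\<lambda>v. c * f v)"

global_interpretation cfun: vector_space "fun_scale :: complex \<Rightarrow> ('v \<Rightarrow> complex) \<Rightarrow> 'v \<Rightarrow> complex"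
  by unfold_locales (auto simp: fun_scale_def fun_eq_iff algebra_simps)

abbreviation linear_form :: "(complex \<Rightarrow> 'v::ab_group_add \<Rightarrow> 'v) \<Rightarrow> ('v \<Rightarrow> complex) \<Rightarrow> bool" where
  "linear_form smul \<phi> \<equiv> Vector_Spaces.linear smul (*) \<phi>"

definition form_products :: "(complex \<Rightarrow> 'v::ab_group_add \<Rightarrow> 'v) \<Rightarrow> nat \<Rightarrow> ('v \<Rightarrow> complex) set" where
  "form_products smul d =
     {(\<lambda>v. \<Prod>j<d. \<phi> j v) | \<phi> :: nat \<Rightarrow> 'v \<Rightarrow> complex. \<forall>j<d. linear_form smul (\<phi> j)}"

definition homogeneous_poly_funs ::
    "(complex \<Rightarrow> 'v::ab_group_add \<Rightarrow> 'v) \<Rightarrow> nat \<Rightarrow> ('v \<Rightarrow> complex) set" where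
  "homogeneous_poly_funs smul d = cfun.span (form_products smul d)"

definition poly_funs :: "(complex \<Rightarrow> 'v::ab_group_add \<Rightarrow> 'v) \<Rightarrow> ('v \<Rightarrow> complex) set" where
  "poly_funs smul = cfun.span (\<Union>d. form_products smul d)"

definition dir_deriv ::
    "(complex \<Rightarrow> 'v::ab_group_add \<Rightarrow> 'v) \<Rightarrow> 'v \<Rightarrow> ('v \<Rightarrow> complex) \<Rightarrow> 'v \<Rightarrow> complex" where
  "dir_deriv smul h f = (\<lambda>v. deriv (\<lambda>t. f (v + smul t h)) 0)"

text \<open>An arrangement of \<open>n\<close> hyperplanes is given by its defining linear forms
  \<open>l 1, \<dots>, l n\<close>, which may repeat or vanish.\<close>

definition form_rank :: "(nat \<Rightarrow> 'v \<Rightarrow> complex) \<Rightarrow> nat set \<Rightarrow> nat" where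
  "form_rank l S = cfun.dim (l ` S)"

definition rho :: "nat \<Rightarrow> (nat \<Rightarrow> 'v \<Rightarrow> complex) \<Rightarrow> 'v \<Rightarrow> nat" where
  "rho n l h = card {i \<in> {1..n}. l i h \<noteq> 0}"

definition central_space ::
    "(complex \<Rightarrow> 'v::ab_group_add \<Rightarrow> 'v) \<Rightarrow> nat \<Rightarrow> (nat \<Rightarrow> 'v \<Rightarrow> complex) \<Rightarrow> ('v \<Rightarrow> complex) set" where
  "central_space smul n l =
     {f \<in> poly_funs smul. \<forall>h. h \<noteq> 0 \<longrightarrow> (dir_deriv smul h ^^ rho n l h) f = (\<lambda>v. 0)}"

definition Hilb ::
    "(complex \<Rightarrow> 'v::ab_group_add \<Rightarrow> 'v) \<Rightarrow> ('v \<Rightarrow> complex) set \<Rightarrow> rat fps" where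
  "Hilb smul C = Abs_fps (\<lambda>i. of_nat (cfun.dim (C \<inter> homogeneous_poly_funs smul i)))"

text \<open>The natural-number subtractions below never truncate, since the rank of \<open>S\<close> is at most
  both the total rank and the cardinality of \<open>S\<close>.\<close>

definition tutte :: "nat \<Rightarrow> (nat \<Rightarrow> 'v \<Rightarrow> complex) \<Rightarrow> 'a::comm_ring_1 \<Rightarrow> 'a \<Rightarrow> 'a" where
  "tutte n l x y =
     (\<Sum>S \<in> Pow {1..n}. (x - 1) ^ (form_rank l {1..n} - form_rank l S)
                        * (y - 1) ^ (card S - form_rank l S))"

end

theory Submission imports Defs begin

text \<open>
  The statement is generalised to a subspace \<open>W\<close> of \<open>V\<close> carrying the restrictions of the forms
  \<open>l i\<close>, \<open>i \<in> I\<close>, and proved by deletion-contraction. If \<open>l i\<close> does not vanish on \<open>W\<close>, restriction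
  to \<open>K = W \<inter> ker (l i)\<close> and multiplication by \<open>l i\<close> give, in every degree \<open>j\<close>, an exact sequence
  \<open>0 \<rightarrow> C\<^sub>j\<^sub>-\<^sub>1(W, I) \<rightarrow> C\<^sub>j(W, I \<union> {i}) \<rightarrow> C\<^sub>j(K, I) \<rightarrow> 0\<close>. Surjectivity is the delicate point: one shows
  along the same induction that \<open>C\<^sub>j(W, I)\<close> is spanned by the products of \<open>j\<close> forms whose complement in
  \<open>I\<close> still spans the dual of \<open>W\<close>, and such products visibly lift. At \<open>x = 1\<close> only the spanning
  subsets contribute to the Tutte polynomial, and the resulting sum satisfies the same recursion.
  Coloops need no separate case, since both sides vanish when \<open>I\<close> does not span the dual of \<open>W\<close>.
\<close>

section \<open>Linear algebra and restriction of functions\<close>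

text \<open>Only \<open>U\<close> is assumed to lie in a finite span, because the function spaces
  used later may be infinite-dimensional. A basis \<open>BN\<close> of the kernel is extended to a
  basis \<open>BU\<close> of \<open>U\<close>; the vectors of \<open>BU - BN\<close> map to a basis
  of the image.\<close>

lemma (in vector_space_pair) rank_nullity_on_subspace:
  assumes f: "Vector_Spaces.linear s1 s2 f" and U: "vs1.subspace U"
    and fin: "finite A" "U \<subseteq> vs1.span A"
  shows "vs1.dim U = vs2.dim (f ` U) + vs1.dim {x \<in> U. f x = 0}"
proof -
  interpret f: Vector_Spaces.linear s1 s2 f by (rule f)
  let ?N = "{x \<in> U. f x = 0}"
  have N: "vs1.subspace ?N"
    using U by (auto simp: vs1.subspace_def f.add f.scale)
  obtain BN where BN: "BN \<subseteq> ?N" "vs1.independent BN" "?N \<subseteq> vs1.span BN"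
    using vs1.maximal_independent_subset by blast
  then obtain BU where BU: "BN \<subseteq> BU" "BU \<subseteq> U" "vs1.independent BU" "U \<subseteq> vs1.span BU"
    using vs1.maximal_independent_subset_extend[of BN U] by blast
  have finBU: "finite BU"
    using vs1.independent_span_bound[OF fin(1) BU(3)] BU(2) fin(2) by auto
  let ?D = "BU - BN"
  have spU: "vs1.span BU = U"
    using BU(2,4) U by (metis vs1.span_subspace)
  have spN: "vs1.span BN = ?N"
    using BN(1,3) N by (metis vs1.span_subspace)
  have inj: "inj_on f (vs1.span ?D)"
    unfolding f.inj_on_iff_eq_0[OF vs1.subspace_span]
  proof safe
    fix x assume x: "x \<in> vs1.span ?D" "f x = 0"
    have "x \<in> U" using x(1) spU vs1.span_mono[of ?D BU] by auto
    then have "x \<in> vs1.span BN" using x(2) spN by simp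
    \<comment> \<open>The coordinates of \<open>x\<close> in \<open>BU\<close> are supported both in
      \<open>BN\<close> and in \<open>BU - BN\<close>, hence nowhere.\<close>
    then have "vs1.representation BU x = vs1.representation BN x"
      using BU(1,3) by (intro vs1.representation_extend)
    moreover have "vs1.representation BU x = vs1.representation ?D x"
      using x(1) BU(3) by (intro vs1.representation_extend) auto
    ultimately have "vs1.representation BU x b = 0" for b
      by (metis DiffD2 vs1.representation_ne_zero)
    then show "x = 0"
      using vs1.sum_nonzero_representation_eq[OF BU(3), of x] \<open>x \<in> U\<close> spU by simp
  qed
  have ind: "vs2.independent (f ` ?D)"
    by (rule f.independent_injective_image[OF _ inj]) (use BU(3) vs1.independent_mono in blast)
  have injD: "inj_on f ?D"
    using inj inj_on_subset vs1.span_superset by blast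
  have img: "f ` U \<subseteq> vs2.span (f ` ?D)"
  proof -
    have "f ` BU \<subseteq> insert 0 (f ` ?D)"
      using BN(1) by auto
    then have "vs2.span (f ` BU) \<subseteq> vs2.span (f ` ?D)"
      using vs2.span_mono vs2.span_insert_0 by metis
    then show ?thesis using f.span_image[of BU] spU by simp
  qed
  have "vs2.dim (f ` U) = card (f ` ?D)"
    by (rule vs2.dim_unique[OF _ img ind refl]) (use BU(2) in auto)
  moreover have "card (f ` ?D) = card BU - card BN"
    using injD finBU BU(1) by (simp add: card_image card_Diff_subset finite_subset)
  moreover have "vs1.dim U = card BU" by (rule vs1.dim_unique[OF BU(2,4,3) refl])
  moreover have "vs1.dim ?N = card BN" by (rule vs1.dim_unique[OF BN(1,3,2) refl])
  ultimately show ?thesis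
    using card_mono[OF finBU BU(1)] by simp
qed

lemma fps_to_fls_sum: "fps_to_fls (\<Sum>x\<in>A. f x) = (\<Sum>x\<in>A. fps_to_fls (f x))"
  by (induction A rule: infinite_finite_induct) simp_all

lemma sum_fun_apply: "(\<Sum>x\<in>A. f x) v = (\<Sum>x\<in>A. f x v)"
  by (induction A rule: infinite_finite_induct) simp_all

text \<open>Functions on a subspace \<open>W\<close> are represented by functions on \<open>V\<close> vanishing outside \<open>W\<close>.\<close>

definition restr :: "'v set \<Rightarrow> ('v \<Rightarrow> complex) \<Rightarrow> 'v \<Rightarrow> complex" where
  "restr W f = (\<lambda>v. if v \<in> W then f v else 0)"

lemma restr_UNIV [simp]: "restr UNIV f = f"
  by (simp add: restr_def)

lemma restr_restr: "restr W (restr K f) = restr (W \<inter> K) f"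
  by (auto simp: restr_def)

lemma linear_restr: "Vector_Spaces.linear fun_scale fun_scale (restr W)"
  by unfold_locales (auto simp: restr_def fun_scale_def fun_eq_iff)

lemma linear_mult_fun: "Vector_Spaces.linear fun_scale fun_scale (\<lambda>g v. \<phi> v * g v)"
  by unfold_locales (auto simp: fun_scale_def fun_eq_iff algebra_simps)

interpretation cfun_pair: vector_space_pair
  "fun_scale :: complex \<Rightarrow> ('v \<Rightarrow> complex) \<Rightarrow> 'v \<Rightarrow> complex"
  "fun_scale :: complex \<Rightarrow> ('w \<Rightarrow> complex) \<Rightarrow> 'w \<Rightarrow> complex"
  by unfold_locales

text \<open>For linear forms \<open>l i\<close> this says that their restrictions to \<open>W\<close>, \<open>i \<in> S\<close>, span the dual of \<open>W\<close>.\<close>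

definition separates :: "(nat \<Rightarrow> 'v \<Rightarrow> complex) \<Rightarrow> 'v::zero set \<Rightarrow> nat set \<Rightarrow> bool" where
  "separates l W S \<longleftrightarrow> (\<forall>h\<in>W. (\<forall>i\<in>S. l i h = 0) \<longrightarrow> h = 0)"

lemma separates_mono: "separates l W S \<Longrightarrow> S \<subseteq> T \<Longrightarrow> separates l W T"
  unfolding separates_def by blast

text \<open>The combinatorial side of contraction: it matches spanning sets containing
  \<open>i\<close> with spanning sets of the kernel, both in the Tutte sum and when products are
  lifted from the kernel.\<close>

lemma separates_insert: "separates l W (insert i S) \<longleftrightarrow> separates l {v \<in> W. l i v = 0} S"
  unfolding separates_def by auto

definition rho_on :: "(nat \<Rightarrow> 'v \<Rightarrow> complex) \<Rightarrow> nat set \<Rightarrow> 'v \<Rightarrow> nat" where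
  "rho_on l I h = card {i \<in> I. l i h \<noteq> 0}"

lemma rho_on_insert:
  "finite I \<Longrightarrow> i \<notin> I \<Longrightarrow>
     rho_on l (insert i I) h = (if l i h = 0 then rho_on l I h else Suc (rho_on l I h))"
proof -
  assume *: "finite I" "i \<notin> I"
  have "{j \<in> insert i I. l j h \<noteq> 0} =
      (if l i h = 0 then {j \<in> I. l j h \<noteq> 0} else insert i {j \<in> I. l j h \<noteq> 0})"
    by auto
  then show ?thesis using * unfolding rho_on_def by auto
qed

section \<open>Homogeneous polynomial functions and their degrees on lines\<close>

locale complex_fd_space = finite_dimensional_vector_space smul B
  for smul :: "complex \<Rightarrow> 'v::ab_group_add \<Rightarrow> 'v" (infixr \<open>*\<^sub>C\<close> 75) and B :: "'v set"
begin

abbreviation hom_funs :: "nat \<Rightarrow> ('v \<Rightarrow> complex) set" where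
  "hom_funs \<equiv> homogeneous_poly_funs smul"

lemma linear_form_iff:
  "linear_form smul \<phi> \<longleftrightarrow> (\<forall>x y. \<phi> (x + y) = \<phi> x + \<phi> y) \<and> (\<forall>c x. \<phi> (c *\<^sub>C x) = c * \<phi> x)"
  using vector_space_axioms vector_space_over_itself.vector_space_axioms
  unfolding Vector_Spaces.linear_iff by blast

lemma
  assumes "linear_form smul \<phi>"
  shows form_add: "\<phi> (x + y) = \<phi> x + \<phi> y" and form_scale: "\<phi> (c *\<^sub>C x) = c * \<phi> x"
    and form_zero: "\<phi> 0 = 0" and form_diff: "\<phi> (x - y) = \<phi> x - \<phi> y"
proof -
  interpret Vector_Spaces.linear smul "(*)" \<phi> by (rule assms)
  show "\<phi> (x + y) = \<phi> x + \<phi> y" "\<phi> (c *\<^sub>C x) = c * \<phi> x" "\<phi> 0 = 0" "\<phi> (x - y) = \<phi> x - \<phi> y"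
    by (simp_all add: add scale zero diff)
qed

lemma subspace_hom_funs: "cfun.subspace (hom_funs d)"
  unfolding homogeneous_poly_funs_def by simp

lemma hom_funs_zero: "(\<lambda>v. 0) \<in> hom_funs d"
  using cfun.subspace_0[OF subspace_hom_funs] by (simp add: zero_fun_def)

lemma hom_funs_add: "f \<in> hom_funs d \<Longrightarrow> g \<in> hom_funs d \<Longrightarrow> (\<lambda>v. f v + g v) \<in> hom_funs d"
  using cfun.subspace_add[OF subspace_hom_funs] by (simp add: plus_fun_def)

lemma hom_funs_scale: "f \<in> hom_funs d \<Longrightarrow> (\<lambda>v. c * f v) \<in> hom_funs d"
  using cfun.subspace_scale[OF subspace_hom_funs] by (simp add: fun_scale_def)

lemma form_products_0: "form_products smul 0 = {\<lambda>v. 1}"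
  by (auto simp: form_products_def)

lemma form_products_Suc:
  "form_products smul (Suc d) = {\<lambda>v. \<phi> v * f v | \<phi> f. linear_form smul \<phi> \<and> f \<in> form_products smul d}"
proof (intro equalityI subsetI)
  fix g assume "g \<in> form_products smul (Suc d)"
  then obtain \<phi> where "\<forall>j<Suc d. linear_form smul (\<phi> j)" "g = (\<lambda>v. \<Prod>j<Suc d. \<phi> j v)"
    unfolding form_products_def by blast
  then have "g = (\<lambda>v. \<phi> d v * (\<Prod>j<d. \<phi> j v))" "linear_form smul (\<phi> d)"
    "(\<lambda>v. \<Prod>j<d. \<phi> j v) \<in> form_products smul d"
    by (auto simp: form_products_def mult.commute)
  then show "g \<in> {\<lambda>v. \<phi> v * f v | \<phi> f. linear_form smul \<phi> \<and> f \<in> form_products smul d}"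
    by (intro CollectI exI[of _ "\<phi> d"] exI[of _ "\<lambda>v. \<Prod>j<d. \<phi> j v"]) simp
next
  fix g assume "g \<in> {\<lambda>v. \<phi> v * f v | \<phi> f. linear_form smul \<phi> \<and> f \<in> form_products smul d}"
  then obtain \<phi> \<psi> where *: "linear_form smul \<phi>" "\<forall>j<d. linear_form smul (\<psi> j)"
    "g = (\<lambda>v. \<phi> v * (\<Prod>j<d. \<psi> j v))"
    unfolding form_products_def by blast
  have "(\<Prod>j<d. (\<psi>(d := \<phi>)) j v) = (\<Prod>j<d. \<psi> j v)" for v
    by (rule prod.cong) auto
  then have "g = (\<lambda>v. \<Prod>j<Suc d. (\<psi>(d := \<phi>)) j v)"
    using *(3) by (simp add: mult.commute)
  moreover have "\<forall>j<Suc d. linear_form smul ((\<psi>(d := \<phi>)) j)"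
    using *(1,2) by (simp add: less_Suc_eq)
  ultimately show "g \<in> form_products smul (Suc d)"
    unfolding form_products_def by blast
qed

lemma form_mult_hom_funs:
  assumes "linear_form smul \<phi>" "f \<in> hom_funs d"
  shows "(\<lambda>v. \<phi> v * f v) \<in> hom_funs (Suc d)"
  using assms(2) unfolding homogeneous_poly_funs_def[of _ d]
proof (induction rule: cfun.span_induct_alt)
  case base
  then show ?case using hom_funs_zero by simp
next
  case (step c x y)
  have "(\<lambda>v. \<phi> v * x v) \<in> form_products smul (Suc d)"
    using step(1) assms(1) unfolding form_products_Suc by blast
  then have "(\<lambda>v. \<phi> v * x v) \<in> hom_funs (Suc d)"
    unfolding homogeneous_poly_funs_def by (rule cfun.span_base)
  from hom_funs_add[OF hom_funs_scale[OF this, of c] step(2)] show ?case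
    by (simp add: fun_scale_def plus_fun_def algebra_simps)
qed

text \<open>Products of forms are built one factor at a time, and linear combinations are taken only
  at the end. The degree is an argument of \<open>Q\<close> so that claims about degree
  \<open>d - 1\<close> can be proved this way.\<close>

lemma hom_funs_induct [consumes 1, case_names one mult zero add scale]:
  assumes f: "f \<in> hom_funs d"
    and one: "Q 0 (\<lambda>v. 1)"
    and mult: "\<And>d \<phi> f. linear_form smul \<phi> \<Longrightarrow> f \<in> hom_funs d \<Longrightarrow> Q d f \<Longrightarrow> Q (Suc d) (\<lambda>v. \<phi> v * f v)"
    and zero: "\<And>d. Q d (\<lambda>v. 0)"
    and add: "\<And>d f g. Q d f \<Longrightarrow> Q d g \<Longrightarrow> Q d (\<lambda>v. f v + g v)"
    and scale: "\<And>d c f. Q d f \<Longrightarrow> Q d (\<lambda>v. c * f v)"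
  shows "Q d f"
proof -
  have *: "Q d f" if "f \<in> form_products smul d" for f
    using that
  proof (induction d arbitrary: f)
    case 0
    then show ?case using one by (simp add: form_products_0)
  next
    case (Suc d)
    then obtain \<phi> g where "linear_form smul \<phi>" "g \<in> form_products smul d" "f = (\<lambda>v. \<phi> v * g v)"
      unfolding form_products_Suc by blast
    moreover from this have "g \<in> hom_funs d"
      unfolding homogeneous_poly_funs_def by (simp add: cfun.span_base)
    ultimately show ?case using mult Suc.IH by blast
  qed
  show ?thesis using f unfolding homogeneous_poly_funs_def
  proof (induction rule: cfun.span_induct_alt)
    case base
    then show ?case using zero by (simp add: zero_fun_def)
  next
    case (step c x y)
    then show ?case using add[OF scale[OF *[OF step(1)], of c] step(2)]
      by (simp add: plus_fun_def fun_scale_def)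
  qed
qed

lemma prod_forms_hom_funs:
  assumes "finite S" "\<And>i. i \<in> S \<Longrightarrow> linear_form smul (l i)"
  shows "(\<lambda>v. \<Prod>i\<in>S. l i v) \<in> hom_funs (card S)"
  using assms
proof (induction S rule: finite_induct)
  case empty
  show ?case unfolding homogeneous_poly_funs_def
    by (rule cfun.span_base) (simp add: form_products_0)
next
  case (insert i S)
  then show ?case using form_mult_hom_funs[of "l i"] by simp
qed

text \<open>The outer variable of \<open>p\<close> is the displacement \<open>s\<close>, the inner
  one is \<open>t\<close>. Thus each coefficient in \<open>t\<close> is visibly a polynomial in
  \<open>s\<close>, as \<open>line_degree_less_cancel_form\<close> requires.\<close>

lemma hom_funs_plane_poly:
  assumes "f \<in> hom_funs d"
  shows "\<exists>p :: complex poly poly. \<forall>s t. f (v + s *\<^sub>C u + t *\<^sub>C h) = poly (poly p [:s:]) t"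
  using assms
proof (induction rule: hom_funs_induct)
  case one
  show ?case by (rule exI[of _ 1]) simp
next
  case (mult d \<phi> f)
  then obtain p where p: "\<forall>s t. f (v + s *\<^sub>C u + t *\<^sub>C h) = poly (poly p [:s:]) t" by blast
  show ?case
    unfolding p[rule_format] form_add[OF mult(1)] form_scale[OF mult(1)]
    \<comment> \<open>The first factor is \<phi> on the plane, namely
      \<open>\<phi> v + t * \<phi> h + s * \<phi> u\<close>.\<close>
    by (rule exI[of _ "[:[:\<phi> v, \<phi> h:], [:\<phi> u:]:] * p"]) (simp add: algebra_simps)
next
  case (zero d)
  show ?case by (rule exI[of _ 0]) simp
next
  case (add d f g)
  then obtain p q where "\<forall>s t. f (v + s *\<^sub>C u + t *\<^sub>C h) = poly (poly p [:s:]) t"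
    "\<forall>s t. g (v + s *\<^sub>C u + t *\<^sub>C h) = poly (poly q [:s:]) t" by blast
  then show ?case by (intro exI[of _ "p + q"]) simp
next
  case (scale d c f)
  then obtain p where "\<forall>s t. f (v + s *\<^sub>C u + t *\<^sub>C h) = poly (poly p [:s:]) t" by blast
  then show ?case by (intro exI[of _ "[:[:c:]:] * p"]) simp
qed

lemma hom_funs_line_poly:
  assumes "f \<in> hom_funs d"
  shows "\<exists>p. \<forall>t. f (v + t *\<^sub>C h) = poly p t"
proof -
  obtain p :: "complex poly poly" where "\<forall>s t. f (v + s *\<^sub>C 0 + t *\<^sub>C h) = poly (poly p [:s:]) t"
    using hom_funs_plane_poly[OF assms] by blast
  then show ?thesis by (intro exI[of _ "poly p [:0:]"]) (metis add.right_neutral scale_zero_right)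
qed

text \<open>Division by \<open>l\<close> with remainder. If \<open>l u = 1\<close>, then
  \<open>v - l v *\<^sub>C u\<close> is the projection to the kernel of \<open>l\<close> along
  \<open>u\<close>, so a polynomial vanishing on that kernel is a multiple of \<open>l\<close>. For
  \<open>d = 0\<close> the quotient 0 stands for degree -1.\<close>

lemma hom_funs_split:
  assumes "f \<in> hom_funs d" and l: "linear_form smul l"
  shows "\<exists>g. (\<forall>v. f v = f (v - l v *\<^sub>C u) + l v * g v) \<and>
     (if d = 0 then g = (\<lambda>v. 0) else g \<in> hom_funs (d - 1))"
  using assms(1)
proof (induction rule: hom_funs_induct)
  case one
  show ?case by (rule exI[of _ "\<lambda>v. 0"]) simp
next
  case (mult d \<phi> f)
  then obtain g where g: "\<forall>v. f v = f (v - l v *\<^sub>C u) + l v * g v"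
     "if d = 0 then g = (\<lambda>v. 0) else g \<in> hom_funs (d - 1)" by blast
  \<comment> \<open>This form is \<phi> at the shifted point. The quotient for the product comes
    from the product rule ab - a'b' = (a - a')b + a'(b - b'), where a = \<phi>, b =
    \<open>f\<close>, primes denote shifted values and a - a' =
    \<open>\<phi> u * l v\<close>.\<close>
  have "linear_form smul (\<lambda>v. \<phi> v - \<phi> u * l v)"
    using mult(1) l unfolding linear_form_iff by (simp add: algebra_simps)
  then have "(\<lambda>v. (\<phi> v - \<phi> u * l v) * g v) \<in> hom_funs d"
    using g(2) form_mult_hom_funs[of "\<lambda>v. \<phi> v - \<phi> u * l v" g "d - 1"] hom_funs_zero
    by (auto split: if_splits)
  from hom_funs_add[OF hom_funs_scale[OF mult(2), of "\<phi> u"] this]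
  have G: "(\<lambda>v. \<phi> u * f v + (\<phi> v - \<phi> u * l v) * g v) \<in> hom_funs d" .
  have eq: "\<phi> v * f v = \<phi> (v - l v *\<^sub>C u) * f (v - l v *\<^sub>C u)
      + l v * (\<phi> u * f v + (\<phi> v - \<phi> u * l v) * g v)" for v
  proof -
    have e: "f (v - l v *\<^sub>C u) = f v - l v * g v" using g(1) by (metis add_diff_cancel_right')
    show ?thesis
      unfolding e form_diff[OF mult(1)] form_scale[OF mult(1)] by (simp add: algebra_simps)
  qed
  show ?case
    by (rule exI[of _ "\<lambda>v. \<phi> u * f v + (\<phi> v - \<phi> u * l v) * g v"], intro conjI allI, rule eq)
      (simp add: G)
next
  case (zero d)
  show ?case by (rule exI[of _ "\<lambda>v. 0"]) (simp add: hom_funs_zero)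
next
  case (add d f f')
  then obtain g g' where g: "\<forall>v. f v = f (v - l v *\<^sub>C u) + l v * g v"
     "if d = 0 then g = (\<lambda>v. 0) else g \<in> hom_funs (d - 1)"
     "\<forall>v. f' v = f' (v - l v *\<^sub>C u) + l v * g' v"
     "if d = 0 then g' = (\<lambda>v. 0) else g' \<in> hom_funs (d - 1)" by blast
  have eq: "f v + f' v = f (v - l v *\<^sub>C u) + f' (v - l v *\<^sub>C u) + l v * (g v + g' v)" for v
    using g(1,3)[rule_format, of v] by (simp add: algebra_simps)
  show ?case
    by (rule exI[of _ "\<lambda>v. g v + g' v"], intro conjI allI, rule eq)
      (use g(2,4) hom_funs_add in auto)
next
  case (scale d c f)
  then obtain g where g: "\<forall>v. f v = f (v - l v *\<^sub>C u) + l v * g v"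
     "if d = 0 then g = (\<lambda>v. 0) else g \<in> hom_funs (d - 1)" by blast
  have eq: "c * f v = c * f (v - l v *\<^sub>C u) + l v * (c * g v)" for v
    using g(1)[rule_format, of v] by (simp add: algebra_simps)
  show ?case
    by (rule exI[of _ "\<lambda>v. c * g v"], intro conjI allI, rule eq)
      (use g(2) hom_funs_scale in auto)
qed

section \<open>Iterated directional derivatives and degrees on lines\<close>

lemma higher_dir_deriv_line:
  assumes "\<And>v. \<forall>t. f (v + t *\<^sub>C h) = poly (p v) t"
  shows "(dir_deriv smul h ^^ k) f (v + t *\<^sub>C h) = poly ((pderiv ^^ k) (p v)) t"
\<comment> \<open>\<open>t\<close> stays arbitrary because the next derivative needs the previous
  one along the whole line.\<close>
proof (induction k arbitrary: t)
  case 0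
  then show ?case using assms by simp
next
  case (Suc k)
  have "(dir_deriv smul h ^^ Suc k) f (v + t *\<^sub>C h)
      = deriv (\<lambda>s. (dir_deriv smul h ^^ k) f (v + (t + s) *\<^sub>C h)) 0"
    by (simp add: dir_deriv_def scale_left_distrib add.assoc)
  also have "\<dots> = deriv (\<lambda>s. poly ((pderiv ^^ k) (p v)) (t + s)) 0"
    using Suc by simp
  also have "\<dots> = poly ((pderiv ^^ Suc k) (p v)) t"
    by (rule DERIV_imp_deriv) (auto intro!: derivative_eq_intros poly_DERIV[THEN DERIV_chain2])
  finally show ?case .
qed

text \<open>Coefficients are used instead of \<open>degree\<close> so that \<open>k = 0\<close>
  means vanishing on the line, which is the condition when \<open>rho_on\<close> is 0.\<close>

definition line_degree_less :: "('v \<Rightarrow> complex) \<Rightarrow> 'v \<Rightarrow> 'v \<Rightarrow> nat \<Rightarrow> bool" where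
  "line_degree_less f v h k \<longleftrightarrow>
     (\<exists>p. (\<forall>t. f (v + t *\<^sub>C h) = poly p t) \<and> (\<forall>i\<ge>k. coeff p i = 0))"

lemma line_degree_lessD:
  "line_degree_less f v h k \<Longrightarrow> \<forall>t. f (v + t *\<^sub>C h) = poly p t \<Longrightarrow> i \<ge> k \<Longrightarrow> coeff p i = 0"
  unfolding line_degree_less_def by (metis poly_eq_poly_eq_iff ext)

text \<open>In characteristic 0 the \<open>k\<close>-th derivative multiplies the coefficient at
  \<open>i + k\<close> by a nonzero Pochhammer factor and moves it to \<open>i\<close>, so it
  vanishes exactly when all coefficients from \<open>k\<close> on do.\<close>

lemma higher_dir_deriv_eq_0_iff:
  assumes "f \<in> hom_funs d"
  shows "(dir_deriv smul h ^^ k) f = (\<lambda>v. 0) \<longleftrightarrow> (\<forall>v. line_degree_less f v h k)"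
proof -
  have "\<forall>v. \<exists>p. \<forall>t. f (v + t *\<^sub>C h) = poly p t"
    using hom_funs_line_poly[OF assms] by blast
  from choice[OF this] obtain p where p: "\<And>v. \<forall>t. f (v + t *\<^sub>C h) = poly (p v) t" by blast
  note * = higher_dir_deriv_line[OF p]
  show ?thesis
  proof
    assume 0: "(dir_deriv smul h ^^ k) f = (\<lambda>v. 0)"
    show "\<forall>v. line_degree_less f v h k"
    proof
      fix v
      have "poly ((pderiv ^^ k) (p v)) t = 0" for t
        using *[of k v t] 0 by simp
      then have "(pderiv ^^ k) (p v) = 0" using poly_all_0_iff_0 by blast
      then have "pochhammer (of_nat (Suc i)) k * coeff (p v) (i + k) = 0" for i
        using coeff_higher_pderiv[of k "p v" i] by simp
      moreover have "pochhammer (of_nat (Suc i) :: complex) k \<noteq> 0" for i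
        using pochhammer_pos[of "Suc i" k] by (metis less_irrefl of_nat_eq_0_iff pochhammer_of_nat zero_less_Suc)
      ultimately have "coeff (p v) (i + k) = 0" for i
        by (metis mult_eq_0_iff)
      then have "coeff (p v) i = 0" if "i \<ge> k" for i
        using that by (metis le_add_diff_inverse2)
      then show "line_degree_less f v h k"
        unfolding line_degree_less_def using p by blast
    qed
  next
    assume d: "\<forall>v. line_degree_less f v h k"
    show "(dir_deriv smul h ^^ k) f = (\<lambda>v. 0)"
    proof
      fix v
      have "coeff (p v) (i + k) = 0" for i
        using line_degree_lessD[OF d[rule_format, of v] p] by simp
      then have "(pderiv ^^ k) (p v) = 0"
        by (intro poly_eqI) (simp add: coeff_higher_pderiv)
      then show "(dir_deriv smul h ^^ k) f v = 0"
        using *[of k v 0] by simp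
    qed
  qed
qed

lemma line_degree_less_zero: "line_degree_less (\<lambda>v. 0) v h k"
  unfolding line_degree_less_def by (rule exI[of _ 0]) simp

lemma line_degree_less_add:
  assumes "line_degree_less f v h k" "line_degree_less g v h k"
  shows "line_degree_less (\<lambda>v. f v + g v) v h k"
proof -
  obtain p q where "\<forall>t. f (v + t *\<^sub>C h) = poly p t" "\<forall>i\<ge>k. coeff p i = 0"
     "\<forall>t. g (v + t *\<^sub>C h) = poly q t" "\<forall>i\<ge>k. coeff q i = 0"
    using assms unfolding line_degree_less_def by blast
  then show ?thesis unfolding line_degree_less_def by (intro exI[of _ "p + q"]) simp
qed

lemma line_degree_less_scale:
  assumes "line_degree_less f v h k"
  shows "line_degree_less (\<lambda>v. c * f v) v h k"
proof -
  obtain p where "\<forall>t. f (v + t *\<^sub>C h) = poly p t" "\<forall>i\<ge>k. coeff p i = 0"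
    using assms unfolding line_degree_less_def by blast
  then show ?thesis unfolding line_degree_less_def by (intro exI[of _ "smult c p"]) simp
qed

lemma line_degree_less_restr:
  assumes "subspace W" "v \<in> W" "h \<in> W"
  shows "line_degree_less (restr W f) v h k \<longleftrightarrow> line_degree_less f v h k"
  using assms by (simp add: line_degree_less_def restr_def subspace_add subspace_scale)

lemma line_degree_less_0D: "line_degree_less f v h 0 \<Longrightarrow> f v = 0"
proof -
  assume "line_degree_less f v h 0"
  then obtain p where "\<forall>t. f (v + t *\<^sub>C h) = poly p t" "\<forall>i. coeff p i = 0"
    unfolding line_degree_less_def by auto
  then show "f v = 0" by (metis add.right_neutral coeff_0 poly_0 poly_eq_iff scale_zero_left)
qed

text \<open>If \<open>l h = 0\<close>, the line through \<open>v\<close> may lie in the kernel of \<open>l\<close>, where \<open>l * g\<close> carries no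
  information; moving it off the kernel along \<open>u\<close> and using that the coefficients of \<open>g\<close> on the moved
  line are polynomials in the displacement \<open>s\<close> recovers this case.\<close>

lemma line_degree_less_cancel_form:
  assumes l: "linear_form smul l" and g: "g \<in> hom_funs d" and u: "l u \<noteq> 0"
    and deg: "\<And>s. line_degree_less (\<lambda>v. l v * g v) (v + s *\<^sub>C u) h (if l h = 0 then k else Suc k)"
  shows "line_degree_less g v h k"
proof (cases "l h = 0")
  case True
  obtain p :: "complex poly poly" where p: "\<And>s t. g (v + s *\<^sub>C u + t *\<^sub>C h) = poly (poly p [:s:]) t"
    using hom_funs_plane_poly[OF g] by blast
  have "coeff (poly p [:0:]) i = 0" if "i \<ge> k" for i
  proof -
    \<comment> \<open>\<open>q\<close> is the coefficient of \<open>t^i\<close> as a polynomial in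
      \<open>s\<close>.\<close>
    define q where "q = map_poly (\<lambda>c. coeff c i) p"
    have q: "coeff (poly p [:s:]) i = poly q s" for s
      unfolding q_def
    proof (induction p)
      case (pCons a p)
      then show ?case by (simp add: map_poly_pCons)
    qed simp
    have "poly q s = 0" if s: "l v + s * l u \<noteq> 0" for s
    proof -
      have "l (v + s *\<^sub>C u + t *\<^sub>C h) * g (v + s *\<^sub>C u + t *\<^sub>C h)
          = poly (smult (l v + s * l u) (poly p [:s:])) t" for t
        using True by (simp add: p form_add[OF l] form_scale[OF l])
      then have "coeff (smult (l v + s * l u) (poly p [:s:])) i = 0"
        using \<open>i \<ge> k\<close> True by (intro line_degree_lessD[OF deg[of s]]) auto
      then show ?thesis using s q by simp
    qed
    \<comment> \<open>The moved line meets the kernel of \<open>l\<close> for a single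
      \<open>s\<close>; at all the others \<open>q\<close> vanishes.\<close>
    then have "- {- l v / l u} \<subseteq> {s. poly q s = 0}"
      using u by (auto simp: field_simps eq_neg_iff_add_eq_0)
    moreover have "infinite (- {- l v / l u} :: complex set)"
      by (simp add: infinite_UNIV_char_0)
    ultimately have "q = 0"
      using poly_roots_finite finite_subset by blast
    then show ?thesis using q[of 0] by simp
  qed
  moreover have "\<forall>t. g (v + t *\<^sub>C h) = poly (poly p [:0:]) t"
    using p[of 0] by simp
  ultimately show ?thesis unfolding line_degree_less_def by blast
next
  case False
  obtain p where p: "\<forall>t. g (v + t *\<^sub>C h) = poly p t"
    using hom_funs_line_poly[OF g] by blast
  have "\<forall>t. l (v + t *\<^sub>C h) * g (v + t *\<^sub>C h) = poly ([:l v, l h:] * p) t"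
    by (simp add: p form_add[OF l] form_scale[OF l] algebra_simps)
  moreover have "line_degree_less (\<lambda>v. l v * g v) v h (Suc k)"
    using deg[of 0] False by simp
  ultimately have c: "coeff ([:l v, l h:] * p) i = 0" if "i \<ge> Suc k" for i
    using line_degree_lessD that by blast
  have "coeff p i = 0" if "i \<ge> k" for i
  proof (cases "p = 0")
    case p0: False
    \<comment> \<open>Since \<open>l h \<noteq> 0\<close>, the form has degree exactly 1 on the
      line, and cancelling it lowers the degree by one.\<close>
    then have "degree ([:l v, l h:] * p) = Suc (degree p)"
      using False by (subst degree_mult_eq) auto
    moreover have "degree ([:l v, l h:] * p) < Suc k"
    proof (rule ccontr)
      assume "\<not> ?thesis"
      then have "lead_coeff ([:l v, l h:] * p) = 0" using c by simp
      then show False using p0 False by (simp add: lead_coeff_mult del: mult_pCons_left)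
    qed
    ultimately show ?thesis using that by (simp add: coeff_eq_0)
  qed simp
  then show ?thesis unfolding line_degree_less_def using p by blast
qed

lemma hom_funs_at_0: "f \<in> hom_funs d \<Longrightarrow> d > 0 \<Longrightarrow> f 0 = 0"
  by (induction rule: hom_funs_induct) (simp_all add: form_zero)

section \<open>Spanning sets and the Tutte polynomial\<close>

lemma subspace_kernel_form:
  assumes "subspace W" "linear_form smul \<phi>"
  shows "subspace {v \<in> W. \<phi> v = 0}"
  using assms by (auto simp: subspace_def form_add form_scale form_zero)

lemma dim_kernel_form:
  assumes W: "subspace W" and \<phi>: "linear_form smul \<phi>" and u: "u \<in> W" "\<phi> u \<noteq> 0"
  shows "dim W = Suc (dim {v \<in> W. \<phi> v = 0})"
proof -
  let ?K = "{v \<in> W. \<phi> v = 0}"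
  have K: "span ?K = ?K" using subspace_kernel_form[OF W \<phi>] by simp
  have "W \<subseteq> span (insert u ?K)"
  proof
    fix v assume v: "v \<in> W"
    have "v - (\<phi> v / \<phi> u) *\<^sub>C u \<in> ?K"
      using v u W \<phi> by (simp add: subspace_diff subspace_scale form_diff form_scale)
    then show "v \<in> span (insert u ?K)"
      unfolding span_breakdown_eq K by blast
  qed
  moreover have "span (insert u ?K) \<subseteq> W"
    using u W by (intro span_minimal) auto
  ultimately have "dim W = dim (insert u ?K)"
    by (metis dim_span subset_antisym)
  also have "\<dots> = Suc (dim ?K)"
    unfolding dim_insert K using u by simp
  finally show ?thesis .
qed

text \<open>Passing to the kernel of one form lowers the dimension by at most one, and after all
  forms of \<open>S\<close> only 0 is left.\<close>

lemma dim_le_card_separates: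
  assumes "finite S" "subspace W" "\<And>i. i \<in> S \<Longrightarrow> linear_form smul (l i)" "separates l W S"
  shows "dim W \<le> card S"
  using assms
proof (induction S arbitrary: W rule: finite_induct)
  case empty
  then have "W \<subseteq> {0}" by (auto simp: separates_def)
  then have "dim W \<le> dim {0}" using dim_subset by blast
  then show ?case by simp
next
  case (insert i S)
  let ?K = "{v \<in> W. l i v = 0}"
  have le: "dim ?K \<le> card S"
    using insert by (intro insert.IH subspace_kernel_form) (auto simp: separates_insert)
  show ?case
  proof (cases "\<exists>u\<in>W. l i u \<noteq> 0")
    case True
    then have "dim W = Suc (dim ?K)" using dim_kernel_form insert.prems by blast
    then show ?thesis using le insert.hyps by simp
  next
    case False
    then have "?K = W" by blast
    then show ?thesis using le insert.hyps by simp
  qed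
qed

text \<open>\<open>q\<^bsup>n-r\<^esup> T(1, 1/q)\<close> with the denominators cleared, written as a sum over spanning sets.\<close>

definition tutte_fps ::
  "(nat \<Rightarrow> 'v \<Rightarrow> complex) \<Rightarrow> 'v set \<Rightarrow> nat set \<Rightarrow> rat fps" where
  "tutte_fps l W I = (\<Sum>S | S \<subseteq> I \<and> separates l W S.
      fps_X ^ (card I - card S) * (1 - fps_X) ^ (card S - dim W))"

text \<open>Spanning sets are sorted by whether they contain \<open>i\<close>. Those without it gain
  a factor X from the larger ground set; those with it come from spanning sets of the kernel. The
  exponent keeps \<open>dim W\<close>, since the relation to the dimension of the kernel separates
  loops from non-loops.\<close>

lemma tutte_fps_insert:
  assumes "finite I" "i \<notin> I"
  shows "tutte_fps l W (insert i I) = fps_X * tutte_fps l W I +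
    (\<Sum>S | S \<subseteq> I \<and> separates l {v \<in> W. l i v = 0} S.
      fps_X ^ (card I - card S) * (1 - fps_X) ^ (Suc (card S) - dim W))"
proof -
  let ?t = "\<lambda>S. fps_X ^ (Suc (card I) - card S) * (1 - fps_X) ^ (card S - dim W) :: rat fps"
  let ?A = "{S. S \<subseteq> I \<and> separates l W S}"
  let ?B = "{S. S \<subseteq> I \<and> separates l {v \<in> W. l i v = 0} S}"
  have set_eq: "{S. S \<subseteq> insert i I \<and> separates l W S} = ?A \<union> insert i ` ?B"
  proof (intro equalityI subsetI)
    fix S assume S: "S \<in> {S. S \<subseteq> insert i I \<and> separates l W S}"
    show "S \<in> ?A \<union> insert i ` ?B"
    proof (cases "i \<in> S")
      case True
      then have "S = insert i (S - {i})" by blast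
      moreover have "S - {i} \<in> ?B"
        using S True separates_insert[of l W i "S - {i}"] by (auto simp: insert_absorb)
      ultimately show ?thesis by blast
    next
      case False
      then show ?thesis using S by blast
    qed
  next
    fix S assume "S \<in> ?A \<union> insert i ` ?B"
    then show "S \<in> {S. S \<subseteq> insert i I \<and> separates l W S}"
      by (auto simp: separates_insert)
  qed
  have fin: "finite ?A" "finite ?B" using assms(1) by auto
  have inj: "inj_on (insert i) ?B"
    using assms(2) by (intro inj_onI) (metis (no_types, lifting) insert_ident mem_Collect_eq subset_iff)
  have "tutte_fps l W (insert i I) = sum ?t ?A + sum ?t (insert i ` ?B)"
    unfolding tutte_fps_def set_eq using assms fin
    by (subst sum.union_disjoint) auto
  also have "sum ?t ?A = fps_X * tutte_fps l W I"
    unfolding tutte_fps_def sum_distrib_left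
  proof (rule sum.cong)
    fix S assume "S \<in> ?A"
    then have "card S \<le> card I" using assms(1) by (simp add: card_mono)
    then show "?t S = fps_X * (fps_X ^ (card I - card S) * (1 - fps_X) ^ (card S - dim W))"
      by (simp add: Suc_diff_le mult.assoc)
  qed simp
  also have "sum ?t (insert i ` ?B) = (\<Sum>S \<in> ?B. ?t (insert i S))"
    using sum.reindex[OF inj] by simp
  also have "\<dots> = (\<Sum>S \<in> ?B. fps_X ^ (card I - card S) * (1 - fps_X) ^ (Suc (card S) - dim W))"
  proof (rule sum.cong)
    fix S assume "S \<in> ?B"
    then have "finite S" "i \<notin> S" using assms finite_subset by auto
    then show "?t (insert i S) = fps_X ^ (card I - card S) * (1 - fps_X) ^ (Suc (card S) - dim W)"
      by simp
  qed simp
  finally show ?thesis .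
qed

lemma tutte_fps_insert_nonloop:
  assumes "finite I" "i \<notin> I" "subspace W" "linear_form smul (l i)" "u \<in> W" "l i u \<noteq> 0"
  shows "tutte_fps l W (insert i I) = fps_X * tutte_fps l W I + tutte_fps l {v \<in> W. l i v = 0} I"
  using tutte_fps_insert[OF assms(1,2)] dim_kernel_form[OF assms(3-)]
  by (simp add: tutte_fps_def[of l "{v \<in> W. l i v = 0}"])

text \<open>Each spanning \<open>S\<close> occurs without and with \<open>i\<close>, with weights X
  and 1 - X, which add up to 1. The bound \<open>dim W \<le> card S\<close> makes the truncated
  exponent grow by exactly one.\<close>

lemma tutte_fps_insert_loop:
  assumes I: "finite I" "i \<notin> I" "\<And>j. j \<in> I \<Longrightarrow> linear_form smul (l j)"
    and W: "subspace W" and loop: "\<And>v. v \<in> W \<Longrightarrow> l i v = 0"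
  shows "tutte_fps l W (insert i I) = tutte_fps l W I"
proof -
  have K: "{v \<in> W. l i v = 0} = W" using loop by blast
  have "(\<Sum>S | S \<subseteq> I \<and> separates l W S.
        fps_X ^ (card I - card S) * (1 - fps_X) ^ (Suc (card S) - dim W))
      = (1 - fps_X) * tutte_fps l W I"
    unfolding tutte_fps_def sum_distrib_left
  proof (rule sum.cong)
    fix S assume "S \<in> {S. S \<subseteq> I \<and> separates l W S}"
    then have "dim W \<le> card S"
      using I W finite_subset by (intro dim_le_card_separates[where l = l]) auto
    then show "fps_X ^ (card I - card S) * (1 - fps_X) ^ (Suc (card S) - dim W)
       = (1 - fps_X) * (fps_X ^ (card I - card S) * (1 - fps_X) ^ (card S - dim W) :: rat fps)"
      by (simp add: Suc_diff_le mult_ac)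
  qed simp
  then show ?thesis using tutte_fps_insert[OF I(1,2), of l W] unfolding K
    by (simp add: algebra_simps)
qed

section \<open>The central space of a restricted arrangement\<close>

text \<open>Degrees on lines replace derivatives: they pass to subspaces and are easy to follow when
  a form is multiplied in or cancelled.\<close>

definition central_part ::
  "(nat \<Rightarrow> 'v \<Rightarrow> complex) \<Rightarrow> 'v set \<Rightarrow> nat set \<Rightarrow> nat \<Rightarrow> ('v \<Rightarrow> complex) set" where
  "central_part l W I j = {f \<in> restr W ` hom_funs j.
     \<forall>h\<in>W. h \<noteq> 0 \<longrightarrow> (\<forall>v\<in>W. line_degree_less f v h (rho_on l I h))}"

text \<open>The degree \<open>j\<close> part of the central P-space of zonotopal algebra, restricted
  to \<open>W\<close>.\<close>

definition product_part ::
  "(nat \<Rightarrow> 'v \<Rightarrow> complex) \<Rightarrow> 'v set \<Rightarrow> nat set \<Rightarrow> nat \<Rightarrow> ('v \<Rightarrow> complex) set" where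
  "product_part l W I j = cfun.span
     {restr W (\<lambda>v. \<Prod>i\<in>S. l i v) | S. S \<subseteq> I \<and> card S = j \<and> separates l W (I - S)}"

lemma subspace_restr_hom_funs: "cfun.subspace (restr W ` hom_funs j)"
proof -
  interpret R: Vector_Spaces.linear fun_scale fun_scale "restr W :: ('v \<Rightarrow> complex) \<Rightarrow> _"
    by (rule linear_restr)
  show ?thesis by (rule R.subspace_image[OF subspace_hom_funs])
qed

lemma subspace_central_part: "cfun.subspace (central_part l W I j)"
proof (rule cfun.subspaceI)
  note sub = subspace_restr_hom_funs[of W j]
  show "0 \<in> central_part l W I j"
    using cfun.subspace_0[OF sub] line_degree_less_zero
    unfolding central_part_def by (simp add: zero_fun_def)
  show "f + g \<in> central_part l W I j"
    if "f \<in> central_part l W I j" "g \<in> central_part l W I j" for f g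
    using that cfun.subspace_add[OF sub] line_degree_less_add
    unfolding central_part_def by (simp add: plus_fun_def)
  show "fun_scale c f \<in> central_part l W I j" if "f \<in> central_part l W I j" for f c
    using that cfun.subspace_scale[OF sub] line_degree_less_scale
    unfolding central_part_def by (simp add: fun_scale_def)
qed

lemma subspace_product_part: "cfun.subspace (product_part l W I j)"
  unfolding product_part_def by simp

lemma central_part_support: "f \<in> central_part l W I j \<Longrightarrow> v \<notin> W \<Longrightarrow> f v = 0"
  unfolding central_part_def restr_def by auto

text \<open>In direction \<open>h\<close> the product over \<open>S\<close> has degree at most the
  number of \<open>i \<in> S\<close> with \<open>l i h \<noteq> 0\<close>. The complement
  \<open>I - S\<close> separates, so it contains a further such \<open>i\<close> and the inequality
  with \<open>rho_on\<close> is strict.\<close>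

lemma product_part_subset_central_part:
  assumes W: "subspace W" and I: "finite I" "\<And>i. i \<in> I \<Longrightarrow> linear_form smul (l i)"
  shows "product_part l W I j \<subseteq> central_part l W I j"
  unfolding product_part_def
proof (rule cfun.span_minimal[OF _ subspace_central_part], safe)
  fix S assume S: "S \<subseteq> I" "j = card S" "separates l W (I - S)"
  let ?f = "\<lambda>v. \<Prod>i\<in>S. l i v"
  have fS: "finite S" using S(1) I(1) finite_subset by blast
  have f: "?f \<in> hom_funs (card S)"
    using prod_forms_hom_funs[OF fS, of l] S(1) I(2) by auto
  have "line_degree_less ?f v h (rho_on l I h)" if h: "h \<in> W" "h \<noteq> 0" for h v
  proof -
    let ?p = "\<Prod>i\<in>S. [:l i v, l i h:]"
    have "?f (v + t *\<^sub>C h) = poly ?p t" for t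
      unfolding poly_prod using S(1) I(2) by (intro prod.cong) (auto simp: form_add form_scale)
    moreover have "degree ?p < rho_on l I h"
    proof -
      have "degree ?p \<le> (\<Sum>i\<in>S. degree [:l i v, l i h:])"
        using degree_prod_sum_le[OF fS, of "\<lambda>i. [:l i v, l i h:]"] by (simp only: o_def)
      also have "\<dots> = (\<Sum>i\<in>S. if l i h \<noteq> 0 then 1 else 0)"
        by (intro sum.cong) auto
      also have "\<dots> = card {i \<in> S. l i h \<noteq> 0}"
        using fS by (simp add: sum.If_cases Int_def)
      also have "\<dots> < card {i \<in> I. l i h \<noteq> 0}"
      proof (rule psubset_card_mono)
        obtain i where "i \<in> I - S" "l i h \<noteq> 0"
          using S(3) h unfolding separates_def by blast
        then show "{i \<in> S. l i h \<noteq> 0} \<subset> {i \<in> I. l i h \<noteq> 0}"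
          using S(1) by blast
      qed (use I(1) in simp)
      finally show ?thesis unfolding rho_on_def .
    qed
    ultimately show ?thesis
      unfolding line_degree_less_def using coeff_eq_0 less_le_trans by (intro exI[of _ ?p]) blast
  qed
  then show "restr W ?f \<in> central_part l W I (card S)"
    using f line_degree_less_restr[OF W] unfolding central_part_def by blast
qed

lemma central_part_not_separates:
  assumes "subspace W" "\<not> separates l W I"
  shows "central_part l W I j = {0}"
proof -
  obtain h where h: "h \<in> W" "h \<noteq> 0" "\<forall>i\<in>I. l i h = 0"
    using assms(2) unfolding separates_def by blast
  then have "{i \<in> I. l i h \<noteq> 0} = {}" by blast
  then have r: "rho_on l I h = 0" unfolding rho_on_def by (simp only: card.empty)
  have "f v = 0" if "f \<in> central_part l W I j" for f v
  proof (cases "v \<in> W")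
    case True
    then have "line_degree_less f v h (rho_on l I h)"
      using that h(1,2) unfolding central_part_def by blast
    then show ?thesis unfolding r by (rule line_degree_less_0D)
  qed (rule central_part_support[OF that])
  then show ?thesis
    using cfun.subspace_0[OF subspace_central_part] by (auto simp: fun_eq_iff)
qed

section \<open>Adding one form: loops, multiplication and restriction\<close>

lemma central_part_insert_loop:
  assumes "finite I" "i \<notin> I" "\<And>v. v \<in> W \<Longrightarrow> l i v = 0"
  shows "central_part l W (insert i I) j = central_part l W I j"
  using assms by (simp add: central_part_def rho_on_insert)

lemma product_part_insert_mono:
  "product_part l W I j \<subseteq> product_part l W (insert i I) j"
  unfolding product_part_def
proof (rule cfun.span_mono, safe)
  fix S assume S: "S \<subseteq> I" "j = card S" "separates l W (I - S)"
  have "separates l W (insert i I - S)"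
    by (rule separates_mono[OF S(3)]) auto
  then show "\<exists>T. restr W (\<lambda>v. \<Prod>i\<in>S. l i v) = restr W (\<lambda>v. \<Prod>i\<in>T. l i v) \<and>
      T \<subseteq> insert i I \<and> card T = card S \<and> separates l W (insert i I - T)"
    using S by blast
qed

text \<open>Putting \<open>i\<close> into the product leaves the complement \<open>I - S\<close>
  unchanged.\<close>

lemma form_mult_product_part:
  assumes I: "finite I" "i \<notin> I" and g: "g \<in> product_part l W I j"
  shows "(\<lambda>v. l i v * g v) \<in> product_part l W (insert i I) (Suc j)"
proof -
  interpret M: Vector_Spaces.linear fun_scale fun_scale "\<lambda>g v. l i v * g v" by (rule linear_mult_fun)
  let ?A = "{restr W (\<lambda>v. \<Prod>i\<in>S. l i v) | S. S \<subseteq> I \<and> card S = j \<and> separates l W (I - S)}"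
  have "(\<lambda>g v. l i v * g v) ` ?A \<subseteq> product_part l W (insert i I) (Suc j)"
  proof safe
    fix S assume S: "S \<subseteq> I" "j = card S" "separates l W (I - S)"
    have fS: "finite S" "i \<notin> S" using S(1) I finite_subset by auto
    have "(\<lambda>v. l i v * restr W (\<lambda>v. \<Prod>i\<in>S. l i v) v) = restr W (\<lambda>v. \<Prod>i\<in>insert i S. l i v)"
      using fS by (auto simp: restr_def)
    moreover have "insert i S \<subseteq> insert i I" "card (insert i S) = Suc (card S)"
       "separates l W (insert i I - insert i S)"
      using S I fS by auto
    ultimately show "(\<lambda>v. l i v * restr W (\<lambda>v. \<Prod>i\<in>S. l i v) v) \<in> product_part l W (insert i I) (Suc (card S))"
      unfolding product_part_def by (intro cfun.span_base) blast
  qed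
  then have "cfun.span ((\<lambda>g v. l i v * g v) ` ?A) \<subseteq> product_part l W (insert i I) (Suc j)"
    using subspace_product_part by (rule cfun.span_minimal)
  then show ?thesis using g unfolding M.span_image product_part_def[of l W I] by blast
qed

text \<open>The lift of a generator is the same product on \<open>W\<close>: there \<open>i\<close>
  joins the complement, which by \<open>separates_insert\<close> still spans.\<close>

lemma product_part_contraction:
  assumes I: "i \<notin> I"
  shows "product_part l {v \<in> W. l i v = 0} I j
    \<subseteq> restr {v \<in> W. l i v = 0} ` product_part l W (insert i I) j" (is "_ \<subseteq> restr ?K ` _")
proof -
  interpret R: Vector_Spaces.linear fun_scale fun_scale "restr ?K" by (rule linear_restr)
  show ?thesis unfolding product_part_def R.span_image[symmetric]
  proof (rule cfun.span_mono, safe)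
    fix S assume S: "S \<subseteq> I" "j = card S" "separates l ?K (I - S)"
    have "insert i I - S = insert i (I - S)" using S(1) I by blast
    then have "separates l W (insert i I - S)" using S(3) by (simp add: separates_insert)
    moreover have "restr ?K (\<lambda>v. \<Prod>i\<in>S. l i v) = restr ?K (restr W (\<lambda>v. \<Prod>i\<in>S. l i v))"
      unfolding restr_restr by (simp add: Int_absorb2)
    ultimately show "restr ?K (\<lambda>v. \<Prod>i\<in>S. l i v) \<in> restr ?K `
       {restr W (\<lambda>v. \<Prod>i\<in>T. l i v) | T. T \<subseteq> insert i I \<and> card T = card S \<and> separates l W (insert i I - T)}"
      using S by blast
  qed
qed

text \<open>Directions in the kernel satisfy \<open>l i h = 0\<close>, so adding \<open>i\<close>
  does not change \<open>rho_on\<close> for them.\<close>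

lemma restr_central_part:
  assumes W: "subspace W" and I: "finite I" "i \<notin> I" and l: "linear_form smul (l i)"
    and f: "f \<in> central_part l W (insert i I) j"
  shows "restr {v \<in> W. l i v = 0} f \<in> central_part l {v \<in> W. l i v = 0} I j"
proof -
  let ?K = "{v \<in> W. l i v = 0}"
  have K: "subspace ?K" by (rule subspace_kernel_form[OF W l])
  obtain f0 where f0: "f0 \<in> hom_funs j" "f = restr W f0"
    using f unfolding central_part_def by blast
  have "restr ?K f = restr ?K f0"
    unfolding f0(2) restr_restr by (simp add: Int_absorb2)
  then have "restr ?K f \<in> restr ?K ` hom_funs j" using f0(1) by simp
  moreover have "line_degree_less (restr ?K f) v h (rho_on l I h)"
    if "h \<in> ?K" "h \<noteq> 0" "v \<in> ?K" for h v
    unfolding line_degree_less_restr[OF K that(3,1)]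
    using that f I by (auto simp: central_part_def rho_on_insert)
  ultimately show ?thesis unfolding central_part_def by blast
qed

text \<open>Exactness in the middle: \<open>hom_funs_split\<close> supplies the quotient by
  \<open>l i\<close>, and \<open>line_degree_less_cancel_form\<close> gives its degree
  bounds.\<close>

lemma central_part_divide:
  assumes W: "subspace W" and I: "finite I" "i \<notin> I" and l: "linear_form smul (l i)"
    and u: "u \<in> W" "l i u \<noteq> 0"
    and f: "f \<in> central_part l W (insert i I) j" and 0: "\<And>v. v \<in> W \<Longrightarrow> l i v = 0 \<Longrightarrow> f v = 0"
  shows "if j = 0 then f = 0 else f \<in> (\<lambda>g v. l i v * g v) ` central_part l W I (j - 1)"
proof -
  obtain f0 where f0: "f0 \<in> hom_funs j" "f = restr W f0"
    using f unfolding central_part_def by blast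
  \<comment> \<open>With \<open>l i u' = 1\<close>, the remainder is evaluated on the kernel of
    \<open>l i\<close> inside \<open>W\<close>, where \<open>f\<close> is 0.\<close>
  define u' where "u' = (1 / l i u) *\<^sub>C u"
  have u': "u' \<in> W" "l i u' = 1"
    using W u l by (simp_all add: u'_def subspace_scale form_scale)
  obtain g where g: "\<forall>v. f0 v = f0 (v - l i v *\<^sub>C u') + l i v * g v"
    "if j = 0 then g = (\<lambda>v. 0) else g \<in> hom_funs (j - 1)"
    using hom_funs_split[OF f0(1) l] by blast
  have f0g: "f0 v = l i v * g v" if "v \<in> W" for v
  proof -
    have "v - l i v *\<^sub>C u' \<in> W" "l i (v - l i v *\<^sub>C u') = 0"
      using that W u' l by (simp_all add: subspace_diff subspace_scale form_diff form_scale)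
    from this 0[OF this] have "f0 (v - l i v *\<^sub>C u') = 0" by (simp add: f0 restr_def)
    then show ?thesis using g(1)[rule_format, of v] by simp
  qed
  have fg: "f = (\<lambda>v. l i v * restr W g v)"
    using f0g by (auto simp: f0 restr_def)
  show ?thesis
  proof (cases "j = 0")
    case True
    then show ?thesis using fg g(2) by (auto simp: restr_def)
  next
    case False
    then have gh: "g \<in> hom_funs (j - 1)" using g(2) by simp
    have "line_degree_less g v h (rho_on l I h)" if h: "h \<in> W" "h \<noteq> 0" and v: "v \<in> W" for h v
    proof (rule line_degree_less_cancel_form[OF l gh u(2)])
      fix s
      have vs: "v + s *\<^sub>C u \<in> W" using v u(1) W by (simp add: subspace_add subspace_scale)
      have "f = restr W (\<lambda>v. l i v * g v)" using fg by (auto simp: restr_def)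
      moreover have "line_degree_less f (v + s *\<^sub>C u) h (rho_on l (insert i I) h)"
        using f h vs unfolding central_part_def by blast
      ultimately show "line_degree_less (\<lambda>v. l i v * g v) (v + s *\<^sub>C u) h
          (if l i h = 0 then rho_on l I h else Suc (rho_on l I h))"
        using line_degree_less_restr[OF W vs h(1)] I by (simp add: rho_on_insert)
    qed
    then have "restr W g \<in> central_part l W I (j - 1)"
      using gh line_degree_less_restr[OF W] unfolding central_part_def by blast
    then show ?thesis using fg False by auto
  qed
qed

lemma form_mult_eq_0_imp:
  assumes W: "subspace W" and l: "linear_form smul \<phi>" and u: "u \<in> W" "\<phi> u \<noteq> 0"
    and g: "g \<in> restr W ` hom_funs j" and 0: "\<And>v. \<phi> v * g v = 0"
  shows "g = 0"
proof -
  obtain g0 where g0: "g0 \<in> hom_funs j" "g = restr W g0" using g by blast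
  have "g0 v = 0" if v: "v \<in> W" for v
  proof -
    \<comment> \<open>Cancellation along the constant line, with direction 0 and bound 0, is a
      statement about the value at \<open>v\<close>.\<close>
    have "line_degree_less g0 v 0 0"
    proof (rule line_degree_less_cancel_form[OF l g0(1) u(2)])
      fix s
      have "v + s *\<^sub>C u \<in> W" using v u(1) W by (simp add: subspace_add subspace_scale)
      then have "\<phi> (v + s *\<^sub>C u) * g0 (v + s *\<^sub>C u) = 0"
        using 0[of "v + s *\<^sub>C u"] by (simp add: g0 restr_def)
      then show "line_degree_less (\<lambda>v. \<phi> v * g0 v) (v + s *\<^sub>C u) 0 (if \<phi> 0 = 0 then 0 else Suc 0)"
        unfolding line_degree_less_def by (intro exI[of _ 0]) simp
    qed
    then show ?thesis by (rule line_degree_less_0D)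
  qed
  then show ?thesis by (auto simp: g0 restr_def)
qed

section \<open>The induction on the set of forms\<close>

lemma central_part_empty:
  assumes W: "subspace W"
  shows "central_part l W {} j = product_part l W {} j"
    and "of_nat (cfun.dim (central_part l W {} j)) = fps_nth (tutte_fps l W {}) j"
proof -
  let ?e = "restr W (\<lambda>v. 1)"
  have T: "{S. S \<subseteq> {} \<and> separates l W S} = (if separates l W {} then {{}} else {})"
    by auto
  have P: "product_part l W {} j = cfun.span (if separates l W {} \<and> j = 0 then {?e} else {})"
    unfolding product_part_def by (rule arg_cong[where f = cfun.span]) auto
  show eq: "central_part l W {} j = product_part l W {} j"
  proof
    show "product_part l W {} j \<subseteq> central_part l W {} j"
      by (rule product_part_subset_central_part[OF W]) auto
    show "central_part l W {} j \<subseteq> product_part l W {} j"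
    proof (cases "separates l W {}")
      case True
      \<comment> \<open>The empty set separates only the zero space, where functions are constants
        and occur only in degree 0.\<close>
      then have W0: "W = {0}" using subspace_0[OF W] by (auto simp: separates_def)
      show ?thesis
      proof
        fix f assume "f \<in> central_part l W {} j"
        then obtain f0 where f0: "f0 \<in> hom_funs j" "f = restr W f0"
          unfolding central_part_def by blast
        have f: "f = fun_scale (f0 0) ?e"
          unfolding f0(2) W0 by (auto simp: restr_def fun_scale_def)
        show "f \<in> product_part l W {} j"
        proof (cases "j = 0")
          case j: True
          have "?e \<in> product_part l W {} j"
            unfolding P using True j by (simp add: cfun.span_base)
          then show ?thesis
            unfolding f using cfun.subspace_scale[OF subspace_product_part] by blast
        next
          case False
          then have "f0 0 = 0" using hom_funs_at_0[OF f0(1)] by simp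
          then show ?thesis
            unfolding f using cfun.subspace_0[OF subspace_product_part] by simp
        qed
      qed
    next
      case False
      then show ?thesis
        using central_part_not_separates[OF W] cfun.subspace_0[OF subspace_product_part] by auto
    qed
  qed
  have "?e 0 = 1" using subspace_0[OF W] by (simp add: restr_def)
  then have e: "?e \<noteq> 0" by (metis zero_fun_apply zero_neq_one)
  have "cfun.dim (product_part l W {} j) = (if separates l W {} \<and> j = 0 then 1 else 0)"
    unfolding P cfun.dim_span using e cfun.dim_eq_card_independent[OF cfun.independent_empty]
    by (auto simp: cfun.dim_eq_card_independent)
  then show "of_nat (cfun.dim (central_part l W {} j)) = fps_nth (tutte_fps l W {}) j"
    unfolding eq tutte_fps_def T by auto
qed

lemma product_part_finitely_generated:
  assumes "finite I"
  shows "\<exists>A. finite A \<and> product_part l W I j = cfun.span A"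
  unfolding product_part_def by (rule exI, rule conjI[OF _ refl]) (simp add: assms)

lemma central_part_insert_nonloop:
  assumes W: "subspace W" and I: "finite I" "i \<notin> I" "\<And>k. k \<in> insert i I \<Longrightarrow> linear_form smul (l k)"
    and u: "u \<in> W" "l i u \<noteq> 0"
    and IH: "\<And>W j. subspace W \<Longrightarrow> central_part l W I j = product_part l W I j"
  shows "central_part l W (insert i I) j = product_part l W (insert i I) j"
    and "cfun.dim (central_part l W (insert i I) j) =
      (if j = 0 then 0 else cfun.dim (central_part l W I (j - 1)))
      + cfun.dim (central_part l {v \<in> W. l i v = 0} I j)"
proof -
  let ?K = "{v \<in> W. l i v = 0}" and ?I = "insert i I"
  let ?C = "central_part l W ?I j"
  \<comment> \<open>The image of multiplication by \<open>l i\<close>; \<open>{0}\<close> stands for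
    the missing degree -1.\<close>
  let ?N = "if j = 0 then {0} else (\<lambda>g v. l i v * g v) ` central_part l W I (j - 1)"
  have li: "linear_form smul (l i)" using I by simp
  have K: "subspace ?K" by (rule subspace_kernel_form[OF W li])
  have PC: "product_part l W ?I j \<subseteq> ?C"
    by (rule product_part_subset_central_part[OF W]) (use I in auto)
  have NP: "?N \<subseteq> product_part l W ?I j"
  proof (cases "j = 0")
    case True
    then show ?thesis using cfun.subspace_0[OF subspace_product_part] by auto
  next
    case False
    then show ?thesis
      using form_mult_product_part[OF I(1,2), of _ l W "j - 1"] IH[OF W, of "j - 1"] by auto
  qed
  have surj: "central_part l ?K I j \<subseteq> restr ?K ` product_part l W ?I j"
    using product_part_contraction[OF I(2), of l W j] IH[OF K] by simp
  have image: "restr ?K ` ?C = central_part l ?K I j"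
    using surj PC restr_central_part[where l = l, OF W I(1,2) li] by blast
  have div: "f \<in> ?N" if f: "f \<in> ?C" and 0: "restr ?K f = 0" for f
  proof -
    have "f v = 0" if "v \<in> W" "l i v = 0" for v
      using fun_cong[OF 0, of v] that by (simp add: restr_def)
    then show ?thesis
      using central_part_divide[where l = l, OF W I(1,2) li u f] by auto
  qed
  have kernel: "{f \<in> ?C. restr ?K f = 0} = ?N"
  proof (intro equalityI subsetI)
    fix f assume "f \<in> ?N"
    moreover from this have "f \<in> ?C" using NP PC by blast
    ultimately show "f \<in> {f \<in> ?C. restr ?K f = 0}"
      by (auto simp: restr_def split: if_splits)
  qed (use div in blast)
  show eq: "?C = product_part l W ?I j"
  proof (intro equalityI subsetI)
    fix f assume f: "f \<in> ?C"
    \<comment> \<open>Products already reach every restriction. The difference \<open>f - p\<close>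
      lies in the kernel \<open>?N\<close>, which consists of combinations of products by the
      hypothesis on \<open>I\<close>.\<close>
    then obtain p where p: "p \<in> product_part l W ?I j" "restr ?K f = restr ?K p"
      using image surj by blast
    have "f - p \<in> ?C"
      using f p(1) PC cfun.subspace_diff[OF subspace_central_part] by blast
    moreover have "restr ?K (f - p) = 0"
    proof
      fix v
      show "restr ?K (f - p) v = 0 v"
        using fun_cong[OF p(2), of v] by (auto simp: restr_def)
    qed
    ultimately have "f - p \<in> product_part l W ?I j" using div NP by blast
    from cfun.subspace_add[OF subspace_product_part this p(1)]
    show "f \<in> product_part l W ?I j" by simp
  qed (use PC in blast)
  \<comment> \<open>The equality just proved supplies the finite generating set for
    rank-nullity.\<close>
  obtain A where A: "finite A" "product_part l W ?I j = cfun.span A"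
    using product_part_finitely_generated[of ?I] I(1) by blast
  have "cfun.dim ?C = cfun.dim (restr ?K ` ?C) + cfun.dim {f \<in> ?C. restr ?K f = 0}"
    by (rule cfun_pair.rank_nullity_on_subspace[OF linear_restr subspace_central_part A(1)])
      (simp only: eq A(2))
  moreover have "cfun.dim ?N = (if j = 0 then 0 else cfun.dim (central_part l W I (j - 1)))"
  proof -
    have dim0: "cfun.dim {0 :: 'v \<Rightarrow> complex} = 0"
      by (rule cfun.dim_unique[of "{}"]) (auto simp: cfun.independent_empty)
    let ?D = "central_part l W I (j - 1)"
    have "g = 0" if "g \<in> ?D" "(\<lambda>v. l i v * g v) = 0" for g
      using form_mult_eq_0_imp[OF W li u, of g "j - 1"] that
      by (simp add: central_part_def fun_eq_iff)
    then have "{g \<in> ?D. (\<lambda>v. l i v * g v) = 0} = {0}"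
      using cfun.subspace_0[OF subspace_central_part, of l W I "j - 1"] by auto
    moreover obtain A' where A': "finite A'" "product_part l W I (j - 1) = cfun.span A'"
      using product_part_finitely_generated[OF I(1)] by blast
    have "cfun.dim ?D = cfun.dim ((\<lambda>g v. l i v * g v) ` ?D)
        + cfun.dim {g \<in> ?D. (\<lambda>v. l i v * g v) = 0}"
      by (rule cfun_pair.rank_nullity_on_subspace[OF linear_mult_fun subspace_central_part A'(1)])
        (simp only: IH[OF W] A'(2))
    ultimately show ?thesis using dim0 by simp
  qed
  ultimately show "cfun.dim ?C = (if j = 0 then 0 else cfun.dim (central_part l W I (j - 1)))
      + cfun.dim (central_part l ?K I j)"
    unfolding image kernel by simp
qed

text \<open>The dimension count needs the product description for surjectivity, so both are proved
  together; \<open>W\<close> varies because contraction replaces it by a kernel.\<close>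

lemma central_part_eq_and_dim:
  assumes "finite I" "\<And>k. k \<in> I \<Longrightarrow> linear_form smul (l k)" "subspace W"
  shows "central_part l W I j = product_part l W I j \<and>
    of_nat (cfun.dim (central_part l W I j)) = fps_nth (tutte_fps l W I) j"
  using assms
proof (induction I arbitrary: W j rule: finite_induct)
  case empty
  then show ?case using central_part_empty by blast
next
  case (insert i I)
  then have IH: "subspace W \<Longrightarrow> central_part l W I j = product_part l W I j"
    "subspace W \<Longrightarrow> of_nat (cfun.dim (central_part l W I j)) = fps_nth (tutte_fps l W I) j" for W j
    by blast+
  have li: "linear_form smul (l i)" using insert.prems by simp
  show ?case
  proof (cases "\<exists>u\<in>W. l i u \<noteq> 0")
    case True
    then obtain u where u: "u \<in> W" "l i u \<noteq> 0" by blast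
    have step: "central_part l W (insert i I) j = product_part l W (insert i I) j"
      "cfun.dim (central_part l W (insert i I) j) =
        (if j = 0 then 0 else cfun.dim (central_part l W I (j - 1)))
        + cfun.dim (central_part l {v \<in> W. l i v = 0} I j)"
      by (rule central_part_insert_nonloop[where l = l, OF insert.prems(2) insert.hyps insert.prems(1) u];
          use IH(1) in blast)+
    have "fps_nth (tutte_fps l W (insert i I)) j =
       (if j = 0 then 0 else fps_nth (tutte_fps l W I) (j - 1)) + fps_nth (tutte_fps l {v \<in> W. l i v = 0} I) j"
      unfolding tutte_fps_insert_nonloop[where l = l, OF insert.hyps insert.prems(2) li u] by simp
    also have "\<dots> = of_nat (cfun.dim (central_part l W (insert i I) j))"
      unfolding step(2) using IH(2)[OF insert.prems(2)] IH(2)[OF subspace_kernel_form[OF insert.prems(2) li]]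
      by simp
    finally show ?thesis using step(1) by simp
  next
    case False
    then have loop: "\<And>v. v \<in> W \<Longrightarrow> l i v = 0" by blast
    have C: "central_part l W (insert i I) j = central_part l W I j"
      using insert.hyps loop by (rule central_part_insert_loop)
    \<comment> \<open>For a loop the inclusions close up: the central part for \<open>I\<close> is
      its product part, which lies in the product part for \<open>insert i I\<close>, hence in the
      unchanged central part.\<close>
    have "product_part l W (insert i I) j \<subseteq> central_part l W (insert i I) j"
      using product_part_subset_central_part[OF insert.prems(2)] insert by blast
    then have "central_part l W (insert i I) j = product_part l W (insert i I) j"
      using product_part_insert_mono[of l W I j i] IH(1)[OF insert.prems(2)] C by auto
    moreover have "tutte_fps l W (insert i I) = tutte_fps l W I"
      using tutte_fps_insert_loop[where l = l, OF insert.hyps _ insert.prems(2) loop] insert.prems(1) by blast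
    ultimately show ?thesis using C IH(2)[OF insert.prems(2), of j] by metis
  qed
qed

section \<open>The Hilbert series of the given arrangement\<close>

lemma central_space_inter_hom_funs:
  "central_space smul n l \<inter> hom_funs j = central_part l UNIV {1..n} j"
proof -
  have "hom_funs j \<subseteq> poly_funs smul"
    unfolding homogeneous_poly_funs_def poly_funs_def by (rule cfun.span_mono) auto
  then show ?thesis
    using higher_dir_deriv_eq_0_iff[of _ j]
    by (auto simp: central_space_def central_part_def rho_def rho_on_def)
qed

lemma Hilb_central_space:
  assumes "\<forall>i\<in>{1..n}. linear_form smul (l i)"
  shows "Hilb smul (central_space smul n l) = tutte_fps l UNIV {1..n}"
proof -
  have "of_nat (cfun.dim (central_part l UNIV {1..n} j)) = fps_nth (tutte_fps l UNIV {1..n}) j" for j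
    using assms by (intro central_part_eq_and_dim[THEN conjunct2]) auto
  then show ?thesis
    unfolding Hilb_def central_space_inter_hom_funs by (intro fps_ext) (simp only: fps_nth_Abs_fps)
qed

section \<open>Full rank and separation of vectors\<close>

lemma ex_dual_basis:
  obtains D where "finite D" "card D \<le> dim UNIV" "\<And>\<phi>. linear_form smul \<phi> \<Longrightarrow> \<phi> \<in> cfun.span D"
    "\<And>h. (\<forall>f\<in>D. f h = 0) \<Longrightarrow> h = 0"
proof
  let ?c = "\<lambda>b v. representation B v b"
  have rep: "(\<Sum>b\<in>B. ?c b v *\<^sub>C b) = v" for v
    using sum_representation_eq[OF independent_Basis _ finite_Basis] span_Basis by simp
  show "finite (?c ` B)" using finite_Basis by simp
  show "card (?c ` B) \<le> dim UNIV" using card_image_le[OF finite_Basis] by simp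
  show "\<phi> \<in> cfun.span (?c ` B)" if \<phi>: "linear_form smul \<phi>" for \<phi>
  proof -
    interpret Vector_Spaces.linear smul "(*)" \<phi> by (rule \<phi>)
    have "\<phi> v = (\<Sum>b\<in>B. ?c b v * \<phi> b)" for v
      using arg_cong[OF rep[of v], of \<phi>] by (simp add: sum scale)
    then have "\<phi> v = (\<Sum>b\<in>B. fun_scale (\<phi> b) (?c b)) v" for v
      unfolding sum_fun_apply fun_scale_def by (subst mult.commute)
    then have "\<phi> = (\<Sum>b\<in>B. fun_scale (\<phi> b) (?c b))"
      by (rule ext)
    then show ?thesis
      by (rule ssubst) (intro cfun.span_sum cfun.span_scale cfun.span_base imageI)
  qed
  show "h = 0" if "\<forall>f\<in>?c ` B. f h = 0" for h
    using rep[of h] that by simp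
qed

lemma form_rank_le_dim:
  assumes "\<And>i. i \<in> S \<Longrightarrow> linear_form smul (l i)"
  shows "form_rank l S \<le> dim UNIV"
proof -
  obtain D where D: "finite D" "card D \<le> dim UNIV" "\<And>\<phi>. linear_form smul \<phi> \<Longrightarrow> \<phi> \<in> cfun.span D"
    using ex_dual_basis by metis
  have "cfun.dim (l ` S) \<le> card D"
    using D(1,3) assms by (intro cfun.dim_le_card) auto
  then show ?thesis using D(2) unfolding form_rank_def by simp
qed

text \<open>A basis of the span of the forms is indexed without repetition by some
  \<open>T \<subseteq> S\<close>. A vector killed by \<open>T\<close> is killed by the whole span,
  so \<open>T\<close> still separates and its size bounds the dimension.\<close>

lemma separates_imp_form_rank:
  assumes "finite S" "\<And>i. i \<in> S \<Longrightarrow> linear_form smul (l i)" "separates l UNIV S"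
  shows "dim UNIV \<le> form_rank l S"
proof -
  obtain L where L: "L \<subseteq> l ` S" "l ` S \<subseteq> cfun.span L" "card L = cfun.dim (l ` S)"
    using cfun.basis_exists[of "l ` S"] by metis
  obtain T where T: "T \<subseteq> S" "L = l ` T" "inj_on l T"
    using subset_image_inj[of L l S] L(1) by blast
  have "h = 0" if h: "\<forall>i\<in>T. l i h = 0" for h
  proof -
    have "f h = 0" if "f \<in> cfun.span L" for f
      using that by (induction rule: cfun.span_induct_alt) (use h T(2) in \<open>auto simp: fun_scale_def\<close>)
    then have "\<forall>i\<in>S. l i h = 0" using L(2) by blast
    then show ?thesis using assms(3) by (simp add: separates_def)
  qed
  then have "separates l UNIV T" by (simp add: separates_def)
  then have "dim UNIV \<le> card T"
    using T(1) assms by (intro dim_le_card_separates[where l = l]) (auto intro: finite_subset)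
  also have "\<dots> = form_rank l S"
    using L(3) T by (simp add: form_rank_def card_image)
  finally show ?thesis .
qed

text \<open>An independent \<open>L\<close> with at least \<open>card D\<close> elements in the span
  of \<open>D\<close> must span \<open>D\<close>, or it could be enlarged beyond
  \<open>card D\<close>. The coordinate functions in \<open>D\<close> separate vectors, hence so do
  the forms.\<close>

lemma form_rank_imp_separates:
  assumes "\<And>i. i \<in> S \<Longrightarrow> linear_form smul (l i)" "form_rank l S = dim UNIV"
  shows "separates l UNIV S"
proof -
  obtain D where D: "finite D" "card D \<le> dim UNIV" "\<And>\<phi>. linear_form smul \<phi> \<Longrightarrow> \<phi> \<in> cfun.span D"
    and D0: "\<And>h. (\<forall>f\<in>D. f h = 0) \<Longrightarrow> h = 0"
    using ex_dual_basis by metis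
  obtain L where L: "L \<subseteq> l ` S" "cfun.independent L" "card L = cfun.dim (l ` S)"
    using cfun.basis_exists[of "l ` S"] by metis
  have LD: "L \<subseteq> cfun.span D" using L(1) D(3) assms(1) by blast
  have fL: "finite L" using cfun.independent_span_bound[OF D(1) L(2) LD] by simp
  have DL: "D \<subseteq> cfun.span L"
  proof
    fix d assume d: "d \<in> D"
    show "d \<in> cfun.span L"
    proof (rule ccontr)
      assume nd: "d \<notin> cfun.span L"
      have "cfun.independent (insert d L)"
        using nd L(2) by (simp add: cfun.independent_insert)
      moreover have "insert d L \<subseteq> cfun.span D" using LD d cfun.span_base by blast
      ultimately have "card (insert d L) \<le> card D"
        using cfun.independent_span_bound[OF D(1)] by blast
      moreover have "d \<notin> L" using nd cfun.span_base by blast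
      ultimately show False
        using fL L(3) D(2) assms(2) unfolding form_rank_def by simp
    qed
  qed
  show ?thesis
    unfolding separates_def
  proof (intro ballI impI)
    fix h assume h: "\<forall>i\<in>S. l i h = 0"
    have "f h = 0" if "f \<in> cfun.span L" for f
      using that by (induction rule: cfun.span_induct_alt) (use h L(1) in \<open>auto simp: fun_scale_def\<close>)
    then show "h = 0" using D0 DL by blast
  qed
qed

lemma separates_iff_form_rank:
  assumes "finite S" "\<And>i. i \<in> S \<Longrightarrow> linear_form smul (l i)"
  shows "separates l UNIV S \<longleftrightarrow> form_rank l S = dim UNIV"
  using form_rank_imp_separates form_rank_le_dim separates_imp_form_rank assms le_antisym by metis

end

text \<open>The dimension of the space equals \<open>r\<close>, so the hyperplanes meet only in 0. A
  nonzero common vector \<open>h\<close> would have \<open>rho\<close> equal to 0 and reduce the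
  central space to 0, while the Tutte side stays nonzero.\<close>

theorem proposition4p14:
  fixes smul :: "complex \<Rightarrow> 'v::ab_group_add \<Rightarrow> 'v"
    and B :: "'v set"
    and l :: "nat \<Rightarrow> 'v \<Rightarrow> complex"
    and n r :: nat
  assumes "finite_dimensional_vector_space smul B"
    and "\<forall>i\<in>{1..n}. linear_form smul (l i)"
    and "form_rank l {1..n} = r"
    and "vector_space.dim smul UNIV = r"
  shows "fps_to_fls (Hilb smul (central_space smul n l)) =
           fls_X ^ (n - r) * tutte n l 1 (1 / fls_X)"
proof -
  interpret complex_fd_space smul B
    using assms(1) by (simp add: complex_fd_space_def)
  let ?q = "fls_X :: rat fls"
  \<comment> \<open>At x = 1 the power of 0 removes the sets of rank below \<open>r\<close> and is
    \<open>0^0 = 1\<close> for the others. For these, \<open>card S - r\<close> factors of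
    \<open>?q\<close> clear the denominators of \<open>1 / ?q - 1\<close>.\<close>
  have term_eq: "?q ^ (n - r) * ((1 - 1) ^ (r - form_rank l S) * (1 / ?q - 1) ^ (card S - form_rank l S))
      = (if separates l UNIV S then ?q ^ (n - card S) * (1 - ?q) ^ (card S - r) else 0)"
    if S: "S \<subseteq> {1..n}" for S
  proof -
    have fS: "finite S" "\<And>i. i \<in> S \<Longrightarrow> linear_form smul (l i)"
      using S assms(2) finite_subset by auto
    note sep = separates_iff_form_rank[OF fS]
    show ?thesis
    proof (cases "separates l UNIV S")
      case True
      then have rank: "form_rank l S = r" using sep assms(4) by simp
      have "r \<le> card S"
        using dim_le_card_separates[OF fS(1) subspace_UNIV fS(2) True] assms(4) by simp
      moreover have "card S \<le> n" using card_mono[OF _ S] by simp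
      ultimately have "n - r = (n - card S) + (card S - r)" by simp
      then have "?q ^ (n - r) * (1 / ?q - 1) ^ (card S - r)
          = ?q ^ (n - card S) * (?q * (1 / ?q - 1)) ^ (card S - r)"
        by (simp only: power_add power_mult_distrib mult.assoc)
      also have "?q * (1 / ?q - 1) = 1 - ?q"
        by (simp only: right_diff_distrib times_divide_eq_right mult_1_right divide_self[OF fls_X_nonzero])
      finally show ?thesis using True rank by simp
    next
      case False
      then have "form_rank l S < r"
        using sep form_rank_le_dim[OF fS(2)] assms(4) by fastforce
      then show ?thesis using False by simp
    qed
  qed
  have "?q ^ (n - r) * tutte n l 1 (1 / ?q) = (\<Sum>S\<in>Pow {1..n}.
      if separates l UNIV S then ?q ^ (n - card S) * (1 - ?q) ^ (card S - r) else 0)"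
    unfolding tutte_def sum_distrib_left assms(3)
    by (rule sum.cong[OF refl]) (use term_eq in blast)
  also have "\<dots> = (\<Sum>S | S \<subseteq> {1..n} \<and> separates l UNIV S. ?q ^ (n - card S) * (1 - ?q) ^ (card S - r))"
    by (simp add: sum.inter_filter[symmetric])
  also have "\<dots> = fps_to_fls (tutte_fps l UNIV {1..n})"
    unfolding tutte_fps_def assms(4)
    by (simp add: fps_to_fls_sum fls_times_fps_to_fls fps_to_fls_power)
  finally show ?thesis using Hilb_central_space[OF assms(2)] by simp
qed

end
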